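(* Let $\Lambda$ be a set and let $\to:\Lambda\times\Lambda\to\mathbb{N}$ be a function such that for every $a\in\Lambda$ the set $\{b\in\Lambda \mid \to(a,b)\neq 0\}$ is finite. Let $\Omega$ be the set of strategies, $\mathtt{P}:\mathcal{P}(\Omega)\to[0,1]$ the set function, and $\mathcal{A}\subseteq\mathcal{P}(\Omega)$ the family of measurable sets associated with $(\Lambda,\to)$ (all defined in the context). Then $(\Omega,\mathcal{A},\mathtt{P})$ (with $\mathtt{P}$ restricted to $\mathcal{A}$) is a probability space.
   Context: Elements of $\Lambda$ are called objects. Write $a\to b$ if $\to(a,b)\neq 0$. The degree of $a\in\Lambda$ is $\rho(a)=\sum_{b}\to(a,b)\in\mathbb{N}$, and $\Lambda^+=\{a\in\Lambda\mid \rho(a)\geq 1\}$ is the set of non-normal objects. A strategy is a total function $f:\Lambda^+\to\Lambda$ such that $f(a)=b$ implies $a\to b$; $\Omega$ is the set of all strategies. A box is a subset $B\subseteq\Omega$ of the form $B=\{f\in\Omega\mid f(a_1)=a_1',\dots,f(a_n)=a_n'\}$ with $n\ge 0$, $a_1,\dots,a_n\in\Lambda^+$ pairwise distinct and $a_1',\dots,a_n'\in\Lambda$ (for $n=0$, $B=\Omega$). For such a box put $\mathtt{p}(B)=\prod_{i=1}^n\frac{\to(a_i,a_i')}{\rho(a_i)}$, the empty product being $1$; by convention $\mathtt{p}(\emptyset)=0$. For $S\subseteq\Omega$: $\mathtt{P}(\emptyset)=0$, and for $S\ne\emptyset$, $\mathtt{P}(S)=\inf\{\sum_{B\in\mathcal{C}}\mathtt{p}(B)\mid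 \mathcal{C}$ is a countable family of boxes with $S\subseteq\bigcup_{B\in\mathcal{C}}B\}$ (finite families count as countable). A set $A\subseteq\Omega$ is (Lebesgue) measurable if for all $S\subseteq\Omega$, $\mathtt{P}(S)=\mathtt{P}(S\cap A)+\mathtt{P}(S\cap(\Omega\setminus A))$; $\mathcal{A}$ is the set of all measurable subsets of $\Omega$. *)

theory Defs
  imports "HOL-Probability.Probability"
begin

text \<open>
  A pair of a carrier \<open>\<Lambda>\<close> and a multiplicity function \<open>red\<close>, where \<open>red a b\<close> counts the reduction
  steps from \<open>a\<close> to \<open>b\<close>; only its values on \<open>\<Lambda> \<times> \<Lambda>\<close> are relevant. The sum defining \<open>degree_at\<close>
  is restricted to the support so that it is the intended one whenever the support is finite,
  even if \<open>\<Lambda>\<close> is infinite.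
\<close>

definition degree_at :: "'a set \<Rightarrow> ('a \<Rightarrow> 'a \<Rightarrow> nat) \<Rightarrow> 'a \<Rightarrow> nat" where
  "degree_at \<Lambda> red a = (\<Sum>b | b \<in> \<Lambda> \<and> red a b \<noteq> 0. red a b)"

definition non_normal :: "'a set \<Rightarrow> ('a \<Rightarrow> 'a \<Rightarrow> nat) \<Rightarrow> 'a set" where
  "non_normal \<Lambda> red = {a \<in> \<Lambda>. degree_at \<Lambda> red a \<ge> 1}"

definition strategies :: "'a set \<Rightarrow> ('a \<Rightarrow> 'a \<Rightarrow> nat) \<Rightarrow> ('a \<Rightarrow> 'a) set" where
  "strategies \<Lambda> red =
     {f \<in> non_normal \<Lambda> red \<rightarrow>\<^sub>E \<Lambda>. \<forall>a \<in> non_normal \<Lambda> red. red a (f a) \<noteq> 0}"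

text \<open>
  The data \<open>a\<^sub>1, \<dots>, a\<^sub>n\<close> (pairwise distinct) and \<open>a\<^sub>1', \<dots>, a\<^sub>n'\<close> of a box are encoded as the finite set
  \<open>D = {a\<^sub>1, \<dots>, a\<^sub>n}\<close> together with a function \<open>g\<close> with \<open>g a\<^sub>i = a\<^sub>i'\<close>.
\<close>

definition box_data :: "'a set \<Rightarrow> ('a \<Rightarrow> 'a \<Rightarrow> nat) \<Rightarrow> 'a set \<Rightarrow> ('a \<Rightarrow> 'a) \<Rightarrow> bool" where
  "box_data \<Lambda> red D g \<longleftrightarrow> finite D \<and> D \<subseteq> non_normal \<Lambda> red \<and> g \<in> D \<rightarrow> \<Lambda>"

definition box_of :: "'a set \<Rightarrow> ('a \<Rightarrow> 'a \<Rightarrow> nat) \<Rightarrow> 'a set \<Rightarrow> ('a \<Rightarrow> 'a) \<Rightarrow> ('a \<Rightarrow> 'a) set" where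
  "box_of \<Lambda> red D g = {f \<in> strategies \<Lambda> red. \<forall>a \<in> D. f a = g a}"

definition boxes :: "'a set \<Rightarrow> ('a \<Rightarrow> 'a \<Rightarrow> nat) \<Rightarrow> ('a \<Rightarrow> 'a) set set" where
  "boxes \<Lambda> red = {box_of \<Lambda> red D g | D g. box_data \<Lambda> red D g}"

definition weight_of :: "'a set \<Rightarrow> ('a \<Rightarrow> 'a \<Rightarrow> nat) \<Rightarrow> 'a set \<Rightarrow> ('a \<Rightarrow> 'a) \<Rightarrow> real" where
  "weight_of \<Lambda> red D g = (\<Prod>a \<in> D. real (red a (g a)) / real (degree_at \<Lambda> red a))"

text \<open>
  The same box can have several descriptions; the weight does not depend on the one chosen, as
  shown in \<open>box_weight_box_of\<close> below.
\<close>

definition box_weight :: "'a set \<Rightarrow> ('a \<Rightarrow> 'a \<Rightarrow> nat) \<Rightarrow> ('a \<Rightarrow> 'a) set \<Rightarrow> real" where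
  "box_weight \<Lambda> red B =
     (if B = {} then 0
      else (THE w. \<exists>D g. box_data \<Lambda> red D g \<and> B = box_of \<Lambda> red D g \<and> w = weight_of \<Lambda> red D g))"

definition strat_outer :: "'a set \<Rightarrow> ('a \<Rightarrow> 'a \<Rightarrow> nat) \<Rightarrow> ('a \<Rightarrow> 'a) set \<Rightarrow> ennreal" where
  "strat_outer \<Lambda> red S =
     (if S = {} then 0
      else (INF C \<in> {C. countable C \<and> C \<subseteq> boxes \<Lambda> red \<and> S \<subseteq> \<Union>C}.
              \<Sum>\<^sub>\<infinity>B\<in>C. ennreal (box_weight \<Lambda> red B)))"

definition strat_measurable :: "'a set \<Rightarrow> ('a \<Rightarrow> 'a \<Rightarrow> nat) \<Rightarrow> ('a \<Rightarrow> 'a) set set" where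
  "strat_measurable \<Lambda> red =
     {A. A \<subseteq> strategies \<Lambda> red \<and>
         (\<forall>S \<subseteq> strategies \<Lambda> red.
            strat_outer \<Lambda> red S =
              strat_outer \<Lambda> red (S \<inter> A) + strat_outer \<Lambda> red (S \<inter> (strategies \<Lambda> red - A)))}"

lemma weight_of_reindex:
  assumes "box_data \<Lambda> red D g" "box_data \<Lambda> red D' g'"
    and eq: "box_of \<Lambda> red D g = box_of \<Lambda> red D' g'" and ne: "box_of \<Lambda> red D g \<noteq> {}"
  shows "weight_of \<Lambda> red D g = weight_of \<Lambda> red (D \<inter> D') g"
proof -
  obtain f where f: "f \<in> box_of \<Lambda> red D g" using ne by blast
  then have f': "f \<in> box_of \<Lambda> red D' g'" using eq by simp
  have "real (red a (g a)) / real (degree_at \<Lambda> red a) = 1" if a: "a \<in> D - D \<inter> D'" for a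
  proof -
    have nn: "a \<in> non_normal \<Lambda> red" using a assms(1) by (auto simp: box_data_def)
    have uniq: "b = g a" if b: "b \<in> \<Lambda>" "red a b \<noteq> 0" for b
    proof -
      have "f(a := b) \<in> box_of \<Lambda> red D' g'"
        using f' a b nn by (auto simp: box_of_def strategies_def PiE_iff extensional_def)
      then have "f(a := b) \<in> box_of \<Lambda> red D g" using eq by simp
      then show ?thesis using a by (auto simp: box_of_def)
    qed
    have "g a \<in> \<Lambda>" "red a (g a) \<noteq> 0"
      using f a nn assms(1) by (auto simp: box_of_def strategies_def box_data_def PiE_iff)
    then have "{b. b \<in> \<Lambda> \<and> red a b \<noteq> 0} = {g a}" using uniq by blast
    then have "degree_at \<Lambda> red a = red a (g a)" unfolding degree_at_def by simp
    then show ?thesis using \<open>red a (g a) \<noteq> 0\<close> by simp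
  qed
  then have *: "\<forall>a \<in> D - D \<inter> D'. real (red a (g a)) / real (degree_at \<Lambda> red a) = 1" by blast
  have "finite D" using assms(1) by (simp add: box_data_def)
  then show ?thesis unfolding weight_of_def
    by (rule prod.mono_neutral_right[OF _ Int_lower1 *])
qed

lemma weight_of_unique:
  assumes "box_data \<Lambda> red D g" "box_data \<Lambda> red D' g'"
    and eq: "box_of \<Lambda> red D g = box_of \<Lambda> red D' g'" and ne: "box_of \<Lambda> red D g \<noteq> {}"
  shows "weight_of \<Lambda> red D g = weight_of \<Lambda> red D' g'"
proof -
  obtain f where f: "f \<in> box_of \<Lambda> red D g" "f \<in> box_of \<Lambda> red D' g'" using ne eq by blast
  have "weight_of \<Lambda> red (D \<inter> D') g = weight_of \<Lambda> red (D' \<inter> D) g'"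
    unfolding weight_of_def using f by (intro prod.cong) (auto simp: box_of_def)
  moreover have "weight_of \<Lambda> red D' g' = weight_of \<Lambda> red (D' \<inter> D) g'"
    using weight_of_reindex[OF assms(2,1) eq[symmetric]] ne unfolding eq by blast
  ultimately show ?thesis using weight_of_reindex[OF assms] by argo
qed

lemma strategy_exists:
  "\<exists>f. f \<in> strategies \<Lambda> red"
proof -
  have "\<exists>b. b \<in> \<Lambda> \<and> red a b \<noteq> 0" if "a \<in> non_normal \<Lambda> red" for a
  proof (rule ccontr)
    assume "\<nexists>b. b \<in> \<Lambda> \<and> red a b \<noteq> 0"
    then have "{b. b \<in> \<Lambda> \<and> red a b \<noteq> 0} = {}" by blast
    then have "degree_at \<Lambda> red a = 0" unfolding degree_at_def by (metis sum.empty)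
    then show False using that by (simp add: non_normal_def)
  qed
  then obtain h where "\<And>a. a \<in> non_normal \<Lambda> red \<Longrightarrow> h a \<in> \<Lambda> \<and> red a (h a) \<noteq> 0" by metis
  then have "restrict h (non_normal \<Lambda> red) \<in> strategies \<Lambda> red"
    by (auto simp: strategies_def)
  then show ?thesis by blast
qed

text \<open>This includes inconsistent constraints: then the box is empty and some factor is \<open>0\<close>.\<close>

lemma box_weight_box_of:
  assumes "box_data \<Lambda> red D g"
  shows "box_weight \<Lambda> red (box_of \<Lambda> red D g) = weight_of \<Lambda> red D g"
proof (cases "box_of \<Lambda> red D g = {}")
  case True
  obtain h where h: "h \<in> strategies \<Lambda> red" using strategy_exists by blast
  have "\<exists>a\<in>D. red a (g a) = 0"
  proof (rule ccontr)
    assume *: "\<not> (\<exists>a\<in>D. red a (g a) = 0)"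
    have "(\<lambda>a. if a \<in> D then g a else h a) \<in> box_of \<Lambda> red D g"
      using * h assms by (auto simp: box_of_def strategies_def box_data_def PiE_iff extensional_def)
    then show False using True by blast
  qed
  then have "weight_of \<Lambda> red D g = 0"
    using assms by (auto simp: weight_of_def box_data_def)
  then show ?thesis using True by (simp add: box_weight_def)
next
  case False
  have "(THE w. \<exists>D' g'. box_data \<Lambda> red D' g' \<and> box_of \<Lambda> red D g = box_of \<Lambda> red D' g' \<and>
           w = weight_of \<Lambda> red D' g') = weight_of \<Lambda> red D g"
  proof (rule the_equality)
    show "\<exists>D' g'. box_data \<Lambda> red D' g' \<and> box_of \<Lambda> red D g = box_of \<Lambda> red D' g' \<and>
            weight_of \<Lambda> red D g = weight_of \<Lambda> red D' g'"
      using assms by blast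
  next
    fix w
    assume "\<exists>D' g'. box_data \<Lambda> red D' g' \<and> box_of \<Lambda> red D g = box_of \<Lambda> red D' g' \<and>
              w = weight_of \<Lambda> red D' g'"
    then obtain D' g' where "box_data \<Lambda> red D' g'" "box_of \<Lambda> red D g = box_of \<Lambda> red D' g'"
      "w = weight_of \<Lambda> red D' g'" by blast
    then show "w = weight_of \<Lambda> red D g"
      using weight_of_unique[OF assms _ _ False] by simp
  qed
  then show ?thesis using False by (simp add: box_weight_def)
qed

lemma strat_outer_le_1:
  assumes "S \<subseteq> strategies \<Lambda> red"
  shows "strat_outer \<Lambda> red S \<le> 1"
proof -
  have data: "box_data \<Lambda> red {} g" for g by (simp add: box_data_def)
  have all: "box_of \<Lambda> red {} g = strategies \<Lambda> red" for g by (simp add: box_of_def)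
  have "strategies \<Lambda> red \<in> boxes \<Lambda> red" 
    unfolding boxes_def using data all[symmetric] by (intro CollectI exI conjI)
  moreover have "box_weight \<Lambda> red (strategies \<Lambda> red) = 1"
    using box_weight_box_of[OF data] by (simp add: all weight_of_def)
  ultimately have "(INF C \<in> {C. countable C \<and> C \<subseteq> boxes \<Lambda> red \<and> S \<subseteq> \<Union>C}.
      \<Sum>\<^sub>\<infinity>B\<in>C. ennreal (box_weight \<Lambda> red B)) \<le> 1"
    using assms by (intro INF_lower2[where i = "{strategies \<Lambda> red}"]) simp_all
  then show ?thesis by (simp add: strat_outer_def)
qed

end

theory Submission imports Defs begin

text \<open>
  The outer set function is an outer measure for general reasons, so Caratheodory's lemma applies.
  The substance is \<open>P \<Omega> \<ge> 1\<close>: the strategies are exactly the points of the product of the finite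
  probability spaces of successors, the product measure of a box is its weight, and a countable
  cover of the whole product space by boxes therefore has total weight at least \<open>1\<close>.
\<close>

text \<open>An \<open>infsum\<close> in \<open>ennreal\<close> is the supremum of its finite
  subsums, which lets estimates of infinite sums be checked on finite sets.\<close>

lemma infsum_ennreal_le_iff:
  fixes f :: "'b \<Rightarrow> ennreal"
  shows "infsum f A \<le> c \<longleftrightarrow> (\<forall>F. finite F \<and> F \<subseteq> A \<longrightarrow> sum f F \<le> c)"
  unfolding nonneg_infsum_complete[where f = f and A = A, simplified]
  by (auto simp: SUP_le_iff)

text \<open>Each \<open>b\<close> in the union lies in some \<open>C i\<close>, so its term is
  counted at least once on the right; overlaps between the \<open>C i\<close> only enlarge that
  side.\<close>

lemma infsum_UN_le_suminf_ennreal: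
  fixes f :: "'b \<Rightarrow> ennreal" and C :: "nat \<Rightarrow> 'b set"
  shows "infsum f (\<Union>i. C i) \<le> (\<Sum>i. infsum f (C i))"
  unfolding infsum_ennreal_le_iff
proof (intro allI impI)
  fix F assume "finite F \<and> F \<subseteq> (\<Union>i. C i)"
  then have F: "finite F" "F \<subseteq> (\<Union>i. C i)" by auto
  have "sum f F \<le> (\<Sum>b\<in>F. \<Sum>i. if b \<in> C i then f b else 0)"
  proof (rule sum_mono)
    fix b assume "b \<in> F"
    then obtain i where "b \<in> C i" using F by blast
    then show "f b \<le> (\<Sum>i. if b \<in> C i then f b else 0)"
      using sum_le_suminf[of "\<lambda>i. if b \<in> C i then f b else 0" "{i}"] by simp
  qed
  also have "\<dots> = (\<Sum>i. \<Sum>b\<in>F. if b \<in> C i then f b else 0)"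
    by (rule suminf_sum[symmetric]) simp
  also have "\<dots> \<le> (\<Sum>i. infsum f (C i))"
  proof (rule suminf_le)
    fix i
    have "(\<Sum>b\<in>F. if b \<in> C i then f b else 0) = sum f (F \<inter> C i)"
      using F(1) by (simp add: sum.inter_restrict)
    also have "\<dots> \<le> infsum f (C i)"
      using infsum_ennreal_le_iff[of f "C i" "infsum f (C i)"] F(1) by simp
    finally show "(\<Sum>b\<in>F. if b \<in> C i then f b else 0) \<le> infsum f (C i)" .
  qed simp_all
  finally show "sum f F \<le> (\<Sum>i. infsum f (C i))" .
qed

text \<open>Carries countable subadditivity from sequences to \<open>infsum\<close> over a countable
  family, the form in which \<open>strat_outer\<close> adds up a cover.\<close>

lemma emeasure_Union_le_infsum:
  assumes C: "countable C" "C \<subseteq> sets M"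
  shows "emeasure M (\<Union>C) \<le> (\<Sum>\<^sub>\<infinity>B\<in>C. emeasure M B)"
proof -
  \<comment> \<open>Padding with \<open>{}\<close> matters when \<open>C\<close> is finite and
    nonempty: outside the range of the enumeration \<open>from_nat_into\<close> would repeat a
    member of \<open>C\<close>, whose measure would be counted again.\<close>
  define h where "h n = (if n \<in> to_nat_on C ` C then from_nat_into C n else {})" for n
  have sets: "range h \<subseteq> sets M"
    using C by (auto simp: h_def)
  have "\<Union>C \<subseteq> (\<Union>n. h n)"
  proof
    fix x assume "x \<in> \<Union>C"
    then obtain B where "B \<in> C" "x \<in> B" by blast
    then have "x \<in> h (to_nat_on C B)" using C by (simp add: h_def)
    then show "x \<in> (\<Union>n. h n)" by blast
  qed
  then have "emeasure M (\<Union>C) \<le> emeasure M (\<Union>n. h n)"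
    using sets by (intro emeasure_mono) auto
  also have "\<dots> \<le> (\<Sum>n. emeasure M (h n))"
    using sets by (rule emeasure_subadditive_countably)
  also have "\<dots> \<le> (\<Sum>\<^sub>\<infinity>B\<in>C. emeasure M B)"
  proof (rule suminf_le_const)
    fix N
    \<comment> \<open>The members of \<open>C\<close> with index below \<open>N\<close>: as the
      enumeration is injective, the partial sum up to \<open>N\<close> is the finite subsum over
      \<open>?F\<close>.\<close>
    let ?F = "{B \<in> C. to_nat_on C B < N}"
    have img: "to_nat_on C ` ?F = {n \<in> {..<N}. n \<in> to_nat_on C ` C}" by auto
    have inj: "inj_on (to_nat_on C) ?F"
      using inj_on_to_nat_on[OF C(1)] by (rule inj_on_subset) auto
    have fin: "finite ?F"
      by (rule finite_imageD[OF _ inj]) (simp add: img)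
    have "(\<Sum>n<N. emeasure M (h n)) = (\<Sum>n\<in>to_nat_on C ` ?F. emeasure M (h n))"
      unfolding img by (rule sum.mono_neutral_right) (auto simp: h_def)
    also have "\<dots> = (\<Sum>B\<in>?F. emeasure M B)"
      using C by (subst sum.reindex[OF inj]) (auto simp: h_def intro!: sum.cong)
    also have "\<dots> \<le> (\<Sum>\<^sub>\<infinity>B\<in>C. emeasure M B)"
      using infsum_ennreal_le_iff[of "emeasure M" C "\<Sum>\<^sub>\<infinity>B\<in>C. emeasure M B"] fin by simp
    finally show "(\<Sum>n<N. emeasure M (h n)) \<le> (\<Sum>\<^sub>\<infinity>B\<in>C. emeasure M B)" .
  qed simp
  finally show ?thesis .
qed

text \<open>The empty family covers the empty set at cost 0, so the infimum agrees with the separate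
  clause for \<open>{}\<close> and later proofs avoid the case split.\<close>

lemma strat_outer_eq_INF:
  "strat_outer \<Lambda> red S =
     (INF C \<in> {C. countable C \<and> C \<subseteq> boxes \<Lambda> red \<and> S \<subseteq> \<Union>C}.
        \<Sum>\<^sub>\<infinity>B\<in>C. ennreal (box_weight \<Lambda> red B))"
proof (cases "S = {}")
  case True
  have "(INF C \<in> {C. countable C \<and> C \<subseteq> boxes \<Lambda> red \<and> S \<subseteq> \<Union>C}.
        \<Sum>\<^sub>\<infinity>B\<in>C. ennreal (box_weight \<Lambda> red B)) \<le> 0"
    using True by (intro INF_lower2[where i = "{}"]) auto
  then show ?thesis using True by (simp add: strat_outer_def)
qed (simp add: strat_outer_def)

lemma strat_outer_mono: "S \<subseteq> T \<Longrightarrow> strat_outer \<Lambda> red S \<le> strat_outer \<Lambda> red T"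
  unfolding strat_outer_eq_INF by (rule INF_superset_mono) auto

lemma strat_outer_UN_le:
  fixes A :: "nat \<Rightarrow> ('a \<Rightarrow> 'a) set"
  shows "strat_outer \<Lambda> red (\<Union>i. A i) \<le> (\<Sum>i. strat_outer \<Lambda> red (A i))"
proof (rule ennreal_le_epsilon)
  let ?P = "strat_outer \<Lambda> red" and ?w = "\<lambda>B. ennreal (box_weight \<Lambda> red B)"
  fix e :: real assume "0 < e" "(\<Sum>i. ?P (A i)) < top"
  \<comment> \<open>A finite total makes every term finite, so adding slack is strict, and
    strictness yields a cover \<open>C i\<close> below the bound. The slacks
    \<open>e * (1/2) ^ Suc i\<close> add up to \<open>e\<close>.\<close>
  then have lt: "?P (A i) < ?P (A i) + e * (1/2) ^ Suc i" for i
    by (auto simp: less_top dest!: ennreal_suminf_lessD)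
  have "\<exists>C. countable C \<and> C \<subseteq> boxes \<Lambda> red \<and> A i \<subseteq> \<Union>C \<and>
          infsum ?w C \<le> ?P (A i) + e * (1/2) ^ Suc i" for i
    using lt[of i] unfolding strat_outer_eq_INF[of _ _ "A i"]
    by (subst (asm) (1) INF_less_iff) (auto intro: less_imp_le)
  then obtain C where C: "\<And>i. countable (C i)" "\<And>i. C i \<subseteq> boxes \<Lambda> red" "\<And>i. A i \<subseteq> \<Union>(C i)"
    and le: "\<And>i. infsum ?w (C i) \<le> ?P (A i) + e * (1/2) ^ Suc i"
    by metis
  have "?P (\<Union>i. A i) \<le> infsum ?w (\<Union>i. C i)"
    unfolding strat_outer_eq_INF
  proof (intro INF_lower CollectI conjI)
    show "countable (\<Union>i. C i)" using C(1) by simp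
    show "(\<Union>i. C i) \<subseteq> boxes \<Lambda> red" using C(2) by blast
    show "(\<Union>i. A i) \<subseteq> \<Union>(\<Union>i. C i)" using C(3) by blast
  qed
  also have "\<dots> \<le> (\<Sum>i. infsum ?w (C i))" by (rule infsum_UN_le_suminf_ennreal)
  also have "\<dots> \<le> (\<Sum>i. ?P (A i) + e * (1/2) ^ Suc i)" by (intro suminf_le le) auto
  also have "\<dots> = (\<Sum>i. ?P (A i)) + (\<Sum>i. ennreal e * ennreal ((1/2) ^ Suc i))"
    using \<open>0 < e\<close> by (subst suminf_add[symmetric])
      (auto simp del: ennreal_suminf_cmult simp add: ennreal_mult[symmetric])
  also have "\<dots> = (\<Sum>i. ?P (A i)) + e"
    unfolding ennreal_suminf_cmult
    by (subst suminf_ennreal_eq[OF zero_le_power power_half_series]) auto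
  finally show "?P (\<Union>i. A i) \<le> (\<Sum>i. ?P (A i)) + e" .
qed

lemma outer_measure_space_strat_outer:
  "outer_measure_space (Pow (strategies \<Lambda> red)) (strat_outer \<Lambda> red)"
  by (auto simp: outer_measure_space_def positive_def increasing_def countably_subadditive_def
      strat_outer_mono strat_outer_UN_le) (simp add: strat_outer_def)

text \<open>The test sets in \<open>strat_measurable\<close> are all subsets of
  \<open>strategies\<close>, so the lambda system is taken in the full power set.\<close>

lemma strat_measurable_eq_lambda_system:
  "strat_measurable \<Lambda> red =
     lambda_system (strategies \<Lambda> red) (Pow (strategies \<Lambda> red)) (strat_outer \<Lambda> red)"
  unfolding strat_measurable_def lambda_system_def by (auto simp: Int_commute)

lemma measure_space_strat_outer:
  "measure_space (strategies \<Lambda> red) (strat_measurable \<Lambda> red) (strat_outer \<Lambda> red)"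
  unfolding strat_measurable_eq_lambda_system
  by (rule sigma_algebra.caratheodory_lemma[OF sigma_algebra_Pow outer_measure_space_strat_outer])

text \<open>The dummy point measure off the non-normal objects only makes every factor a probability space.\<close>

definition succ_measure :: "'a set \<Rightarrow> ('a \<Rightarrow> 'a \<Rightarrow> nat) \<Rightarrow> 'a \<Rightarrow> 'a measure" where
  "succ_measure \<Lambda> red a =
     (if a \<in> non_normal \<Lambda> red
      then point_measure {b \<in> \<Lambda>. red a b \<noteq> 0}
             (\<lambda>b. ennreal (real (red a b) / real (degree_at \<Lambda> red a)))
      else return (count_space UNIV) undefined)"

locale finite_branching =
  fixes \<Lambda> :: "'a set" and red :: "'a \<Rightarrow> 'a \<Rightarrow> nat"
  assumes finite_succ: "a \<in> \<Lambda> \<Longrightarrow> finite {b \<in> \<Lambda>. red a b \<noteq> 0}"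
begin

text \<open>The degree is the sum of the finitely many nonzero multiplicities, so the quotients add
  up to 1; non-normality keeps the denominator nonzero.\<close>

lemma prob_space_succ_measure: "prob_space (succ_measure \<Lambda> red a)"
proof (cases "a \<in> non_normal \<Lambda> red")
  case True
  then have fin: "finite {b \<in> \<Lambda>. red a b \<noteq> 0}" and deg: "degree_at \<Lambda> red a \<noteq> 0"
    using finite_succ by (auto simp: non_normal_def)
  have "(\<Sum>b | b \<in> \<Lambda> \<and> red a b \<noteq> 0. ennreal (real (red a b) / real (degree_at \<Lambda> red a)))
      = ennreal ((\<Sum>b | b \<in> \<Lambda> \<and> red a b \<noteq> 0. real (red a b)) / real (degree_at \<Lambda> red a))"
    by (simp add: sum_divide_distrib)
  also have "(\<Sum>b | b \<in> \<Lambda> \<and> red a b \<noteq> 0. real (red a b)) = real (degree_at \<Lambda> red a)"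
    by (simp add: degree_at_def)
  finally show ?thesis
    using True fin deg by (simp add: succ_measure_def prob_space_point_measure)
qed (simp add: succ_measure_def prob_space_return)

text \<open>The index set may have any cardinality: the product of arbitrarily many probability
  spaces exists.\<close>

sublocale product_prob_space "succ_measure \<Lambda> red" "non_normal \<Lambda> red"
  by (intro product_prob_space.intro product_prob_space_axioms.intro product_sigma_finite.intro
      prob_space_succ_measure prob_space_imp_sigma_finite)

abbreviation strat_prod :: "('a \<Rightarrow> 'a) measure" where
  "strat_prod \<equiv> PiM (non_normal \<Lambda> red) (succ_measure \<Lambda> red)"

text \<open>Points of the product are extensional and take successors as values, just as
  \<open>strategies\<close> demands.\<close>

lemma space_strat_prod: "space strat_prod = strategies \<Lambda> red"
  by (auto simp: space_PiM PiE_iff strategies_def succ_measure_def space_point_measure extensional_def)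

text \<open>A box constrains finitely many coordinates, hence is a cylinder whose measure is a
  finite product of factor measures.\<close>

lemma
  assumes D: "box_data \<Lambda> red D g"
  shows sets_strat_prod_box: "box_of \<Lambda> red D g \<in> sets strat_prod"
    and emeasure_strat_prod_box: "emeasure strat_prod (box_of \<Lambda> red D g) = weight_of \<Lambda> red D g"
proof -
  \<comment> \<open>Box data only ask for \<open>g a\<close> in \<Lambda>. If \<open>g a\<close> is
    not a successor of \<open>a\<close>, the singleton leaves the factor space; cutting down to
    successors gives \<open>{}\<close>, of measure 0, matching the zero factor in the
    weight.\<close>
  define X where "X a = {g a} \<inter> {b \<in> \<Lambda>. red a b \<noteq> 0}" for a
  have fin: "finite D" and sub: "D \<subseteq> non_normal \<Lambda> red" and g: "\<And>a. a \<in> D \<Longrightarrow> g a \<in> \<Lambda>"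
    using D by (auto simp: box_data_def)
  have X: "X a \<in> sets (succ_measure \<Lambda> red a)" if "a \<in> D" for a
    using that sub by (auto simp: succ_measure_def sets_point_measure X_def)
  have box: "box_of \<Lambda> red D g = {f \<in> space strat_prod. \<forall>a\<in>D. f a \<in> X a}"
    using sub unfolding space_strat_prod
    by (fastforce simp: box_of_def strategies_def X_def PiE_iff)
  show "box_of \<Lambda> red D g \<in> sets strat_prod"
    unfolding box using fin X by measurable (use sub in auto)
  have "emeasure strat_prod (box_of \<Lambda> red D g) = (\<Prod>a\<in>D. emeasure (succ_measure \<Lambda> red a) (X a))"
    unfolding box using fin sub X by (intro emeasure_PiM_Collect) auto
  also have "\<dots> = (\<Prod>a\<in>D. ennreal (real (red a (g a)) / real (degree_at \<Lambda> red a)))"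
  proof (rule prod.cong)
    fix a assume a: "a \<in> D"
    then have "a \<in> non_normal \<Lambda> red" using sub by auto
    moreover from this have "finite {b \<in> \<Lambda>. red a b \<noteq> 0}"
      using finite_succ by (auto simp: non_normal_def)
    moreover have "X a = (if red a (g a) = 0 then {} else {g a})"
      using g[OF a] by (auto simp: X_def)
    ultimately show "emeasure (succ_measure \<Lambda> red a) (X a)
        = ennreal (real (red a (g a)) / real (degree_at \<Lambda> red a))"
      using g[OF a] by (auto simp: succ_measure_def emeasure_point_measure_finite)
  qed simp
  also have "\<dots> = weight_of \<Lambda> red D g"
    by (simp add: weight_of_def prod_ennreal)
  finally show "emeasure strat_prod (box_of \<Lambda> red D g) = weight_of \<Lambda> red D g" .
qed

lemma strat_outer_strategies: "strat_outer \<Lambda> red (strategies \<Lambda> red) = 1"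
proof (rule antisym[OF strat_outer_le_1])
  show "1 \<le> strat_outer \<Lambda> red (strategies \<Lambda> red)"
    unfolding strat_outer_eq_INF
  proof (rule INF_greatest, clarify)
    fix C assume C: "countable C" "C \<subseteq> boxes \<Lambda> red" "strategies \<Lambda> red \<subseteq> \<Union>C"
    \<comment> \<open>Any description of \<open>B\<close> will do: \<open>box_weight_box_of\<close>
      gives the same weight for all of them, also when \<open>B\<close> is empty.\<close>
    have box: "B \<in> sets strat_prod \<and> emeasure strat_prod B = box_weight \<Lambda> red B"
      if B: "B \<in> C" for B
    proof -
      obtain D g where "box_data \<Lambda> red D g" "B = box_of \<Lambda> red D g"
        using B C(2) unfolding boxes_def by blast
      then show ?thesis
        by (simp add: sets_strat_prod_box emeasure_strat_prod_box box_weight_box_of)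
    qed
    have "1 = emeasure strat_prod (space strat_prod)"
      by (rule P.emeasure_space_1[symmetric])
    also have "\<dots> \<le> emeasure strat_prod (\<Union>C)"
      using C box by (intro emeasure_mono) (auto simp: space_strat_prod)
    also have "\<dots> \<le> (\<Sum>\<^sub>\<infinity>B\<in>C. emeasure strat_prod B)"
      using C(1) box by (intro emeasure_Union_le_infsum) auto
    also have "\<dots> = (\<Sum>\<^sub>\<infinity>B\<in>C. ennreal (box_weight \<Lambda> red B))"
      using box by (intro infsum_cong) auto
    finally show "1 \<le> (\<Sum>\<^sub>\<infinity>B\<in>C. ennreal (box_weight \<Lambda> red B))" .
  qed
qed simp

end

theorem theorem3p11:
  fixes \<Lambda> :: "'a set" and red :: "'a \<Rightarrow> 'a \<Rightarrow> nat"
  assumes "\<And>a. a \<in> \<Lambda> \<Longrightarrow> finite {b \<in> \<Lambda>. red a b \<noteq> 0}"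
  shows "measure_space (strategies \<Lambda> red) (strat_measurable \<Lambda> red) (strat_outer \<Lambda> red) \<and>
         prob_space (measure_of (strategies \<Lambda> red) (strat_measurable \<Lambda> red) (strat_outer \<Lambda> red))"
proof
  interpret finite_branching \<Lambda> red by unfold_locales (rule assms)
  let ?N = "measure_of (strategies \<Lambda> red) (strat_measurable \<Lambda> red) (strat_outer \<Lambda> red)"
  show ms: "measure_space (strategies \<Lambda> red) (strat_measurable \<Lambda> red) (strat_outer \<Lambda> red)"
    by (rule measure_space_strat_outer)
  then interpret sigma_algebra "strategies \<Lambda> red" "strat_measurable \<Lambda> red"
    by (simp add: measure_space_def)
  \<comment> \<open>\<open>measure_of\<close> falls back to the zero measure unless its function is
    a measure on the generated sigma algebra; \<open>ms\<close> excludes this, the family being a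
    sigma algebra already.\<close>
  have "emeasure ?N (strategies \<Lambda> red) = strat_outer \<Lambda> red (strategies \<Lambda> red)"
    using ms by (intro emeasure_measure_of_sigma) (auto simp: measure_space_def)
  moreover have "space ?N = strategies \<Lambda> red"
    using space_closed by (rule space_measure_of)
  ultimately show "prob_space ?N"
    by (intro prob_spaceI) (simp add: strat_outer_strategies)
qed

end
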